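(* Let $\rho>0$ and let $g_1\ge g_2>0$ be the effective channel gains of the strong user (user 1) and the weak user (user 2). Let $\alpha_{1'}^2,\alpha_{2'}^2\in[0,1]$ with $\alpha_{1'}^2+\alpha_{2'}^2=1$ be an arbitrary power allocation for OMA, where OMA uses equal degrees of freedom $\lambda_1=\lambda_2=\tfrac12$. Put $$L=\frac{\sqrt{1+2\rho\alpha_{1'}^2g_1}-1}{\rho g_1},\qquad U=\frac{1+\rho g_2-\sqrt{1+2\rho\alpha_{2'}^2g_2}}{\rho g_2\sqrt{1+2\rho\alpha_{2'}^2g_2}}.$$ Then $L\le U$, and every $\alpha_1^2$ with $L\le\alpha_1^2\le U$ lies in $[0,1]$ and, with $\alpha_2^2=1-\alpha_1^2$, gives each user in NOMA an individual rate at least as large as in OMA, i.e. $$\log_2(1+\rho\alpha_1^2g_1)\ge\tfrac12\log_2(1+2\rho\alpha_{1'}^2g_1),$$ $$\log_2\left(1+\frac{\rho\alpha_2^2g_2}{1+\rho\alpha_1^2g_2}\right)\ge\tfrac12\log_2(1+2\rho\alpha_{2'}^2g_2).$$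
   Context: Setting: two users in one cluster of a downlink MIMO system; $g_k=|\mathbf v_k^H\mathbf H_k\mathbf p|^2$ is the effective channel gain of user $k$ (with $\mathbf v_k$ the receive beamforming vector, $\mathbf H_k$ the channel matrix, $\mathbf p$ the common transmit beamforming vector), and $\rho>0$ is the inverse noise power. Only the positive numbers $g_1\ge g_2$ and $\rho$ matter. In NOMA with power coefficients $\alpha_1^2+\alpha_2^2=1$, the individual rates are $R_1^{\mathrm{NOMA}}=\log_2(1+\rho\alpha_1^2g_1)$ and $R_2^{\mathrm{NOMA}}=\log_2\left(1+\frac{\rho\alpha_2^2g_2}{1+\rho\alpha_1^2g_2}\right)$. In OMA with power coefficients $\alpha_{1'}^2+\alpha_{2'}^2=1$ and equal degrees of freedom, the individual rates are $R_k^{\mathrm{OMA}}=\tfrac12\log_2(1+2\rho\alpha_{k'}^2g_k)$. *)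

theory Defs
  imports Complex_Main
begin

(* The power fractions a = \<alpha>\<^sup>2 are themselves the variables: a1, a2 stand for the squared
   NOMA coefficients of the strong and the weak user, a1', a2' for the squared OMA
   coefficients. A channel gain g is the real number |v^H H p|^2, and \<rho> is the inverse
   noise power. *)

(* The strong user decodes after removing the weak user's signal. *)
definition noma_rate_strong :: "real \<Rightarrow> real \<Rightarrow> real \<Rightarrow> real" where
  "noma_rate_strong \<rho> g1 a1 = log 2 (1 + \<rho> * a1 * g1)"

(* The strong user's signal is interference for the weak user. *)
definition noma_rate_weak :: "real \<Rightarrow> real \<Rightarrow> real \<Rightarrow> real \<Rightarrow> real" where
  "noma_rate_weak \<rho> g2 a1 a2 = log 2 (1 + \<rho> * a2 * g2 / (1 + \<rho> * a1 * g2))"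

(* Equal degrees of freedom: each user gets the fraction 1/2, which is the prefactor and
   also doubles the signal-to-noise ratio. *)
definition oma_rate :: "real \<Rightarrow> real \<Rightarrow> real \<Rightarrow> real" where
  "oma_rate \<rho> g a' = 1 / 2 * log 2 (1 + 2 * \<rho> * a' * g)"

definition noma_lower :: "real \<Rightarrow> real \<Rightarrow> real \<Rightarrow> real" where
  "noma_lower \<rho> g1 a1' = (sqrt (1 + 2 * \<rho> * a1' * g1) - 1) / (\<rho> * g1)"

definition noma_upper :: "real \<Rightarrow> real \<Rightarrow> real \<Rightarrow> real" where
  "noma_upper \<rho> g2 a2' =
     (1 + \<rho> * g2 - sqrt (1 + 2 * \<rho> * a2' * g2)) / (\<rho> * g2 * sqrt (1 + 2 * \<rho> * a2' * g2))"

end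

(* If the strong user's gain is lowered to that of the weak user, L grows, because it equals
   2 a1' / (sqrt (1 + 2 \<rho> a1' g1) + 1). With equal gains g, the inequality L \<le> U says that
   the product of the two OMA square roots is at most 1 + \<rho> g; this is AM-GM, since their
   squares add up to 2 (1 + \<rho> g). *)

theory Submission
  imports Defs
begin

text \<open>Rationalising the numerator with \<open>s + 1\<close> cancels the factor
  \<open>\<rho> * g\<close>. The gain then survives only under the root in the denominator, so both
  the sign and the monotonicity in the gain can be read off.\<close>

lemma noma_lower_eq:
  assumes "\<rho> > 0" "g > 0" "a' \<ge> 0"
  shows "noma_lower \<rho> g a' = 2 * a' / (sqrt (1 + 2 * \<rho> * a' * g) + 1)"
proof -
  define s where "s = sqrt (1 + 2 * \<rho> * a' * g)"
  have "s\<^sup>2 = 1 + 2 * \<rho> * a' * g" "s \<ge> 0"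
    using assms by (simp_all add: s_def)
  then have "(s - 1) * (s + 1) = 2 * a' * (\<rho> * g)"
    by (simp add: power2_eq_square algebra_simps)
  then show ?thesis
    unfolding noma_lower_def s_def[symmetric]
    using assms \<open>s \<ge> 0\<close> by (subst frac_eq_eq) auto
qed

lemma noma_lower_antimono:
  assumes "\<rho> > 0" "0 < g" "g \<le> h" "a' \<ge> 0"
  shows "noma_lower \<rho> h a' \<le> noma_lower \<rho> g a'"
proof -
  have "sqrt (1 + 2 * \<rho> * a' * g) \<le> sqrt (1 + 2 * \<rho> * a' * h)"
    using assms by (simp add: mult_left_mono)
  moreover have "sqrt (1 + 2 * \<rho> * a' * g) \<ge> 0"
    using assms by simp
  ultimately show ?thesis
    using assms by (auto simp: noma_lower_eq intro!: divide_left_mono mult_pos_pos add_nonneg_pos)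
qed

lemma noma_lower_nonneg:
  assumes "\<rho> > 0" "g > 0" "a' \<ge> 0"
  shows "noma_lower \<rho> g a' \<ge> 0"
  using assms by (simp add: noma_lower_eq)

text \<open>Clearing the positive denominator turns the bound into a product condition. It serves
  twice: AM-GM applies to it directly, and dividing it by \<open>1 + \<rho> * a * g\<close> gives
  the weak user's rate condition.\<close>

lemma le_noma_upper_iff:
  assumes "\<rho> > 0" "g > 0" "a' \<ge> 0"
  shows "a \<le> noma_upper \<rho> g a' \<longleftrightarrow> (1 + \<rho> * a * g) * sqrt (1 + 2 * \<rho> * a' * g) \<le> 1 + \<rho> * g"
proof -
  have "sqrt (1 + 2 * \<rho> * a' * g) > 0"
    using assms by (simp add: add_pos_nonneg)
  then show ?thesis
    using assms by (simp add: noma_upper_def pos_le_divide_eq algebra_simps)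
qed

lemma noma_lower_le_noma_upper:
  assumes "\<rho> > 0" "g > 0" "a \<ge> 0" "b \<ge> 0" "a + b = 1"
  shows "noma_lower \<rho> g a \<le> noma_upper \<rho> g b"
proof -
  define s t where "s = sqrt (1 + 2 * \<rho> * a * g)" and "t = sqrt (1 + 2 * \<rho> * b * g)"
  have "s\<^sup>2 + t\<^sup>2 = 2 + 2 * \<rho> * g * (a + b)"
    using assms(1-4) by (simp add: s_def t_def algebra_simps)
  then have "s * t \<le> 1 + \<rho> * g"
    using assms(5) sum_squares_bound[of s t] by simp
  \<comment> \<open>The lower bound is the fraction at which the strong user's NOMA argument equals
    \<open>s\<close>, so at this point the product condition for the upper bound becomes
    \<open>s * t \<le> 1 + \<rho> * g\<close>.\<close>
  moreover have "1 + \<rho> * noma_lower \<rho> g a * g = s"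
    using assms by (simp add: noma_lower_def s_def)
  ultimately show ?thesis
    using assms by (simp add: le_noma_upper_iff t_def)
qed

lemma noma_upper_le_1:
  assumes "\<rho> > 0" "g > 0" "a' \<ge> 0"
  shows "noma_upper \<rho> g a' \<le> 1"
proof -
  define t where "t = sqrt (1 + 2 * \<rho> * a' * g)"
  have "t \<ge> 1"
    using assms by (simp add: t_def)
  \<comment> \<open>This is the claim with its denominator \<open>\<rho> * g * t\<close> cleared and
    \<open>t\<close> moved to the right.\<close>
  then have "(1 + \<rho> * g) * 1 \<le> (1 + \<rho> * g) * t"
    using assms by (intro mult_left_mono) auto
  then show ?thesis
    unfolding noma_upper_def t_def[symmetric]
    using assms \<open>t \<ge> 1\<close> by (subst pos_divide_le_eq) (auto simp: algebra_simps)
qed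

text \<open>The prefactor 1/2 becomes a square root inside the logarithm, so comparing rates reduces
  to comparing the arguments of \<open>log 2\<close>.\<close>

lemma oma_rate_eq:
  assumes "\<rho> > 0" "g > 0" "a' \<ge> 0"
  shows "oma_rate \<rho> g a' = log 2 (sqrt (1 + 2 * \<rho> * a' * g))"
proof -
  have "1 + 2 * \<rho> * a' * g > 0"
    using assms by (simp add: add_pos_nonneg)
  then show ?thesis
    by (simp add: oma_rate_def log_def ln_sqrt)
qed

lemma oma_rate_le_noma_rate_strong:
  assumes "\<rho> > 0" "g > 0" "a' \<ge> 0" "noma_lower \<rho> g a' \<le> a"
  shows "oma_rate \<rho> g a' \<le> noma_rate_strong \<rho> g a"
proof -
  have "sqrt (1 + 2 * \<rho> * a' * g) > 0"
    using assms by (simp add: add_pos_nonneg)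
  moreover have "sqrt (1 + 2 * \<rho> * a' * g) \<le> 1 + \<rho> * a * g"
    using assms by (simp add: noma_lower_def pos_divide_le_eq algebra_simps)
  ultimately show ?thesis
    using assms by (simp add: oma_rate_eq noma_rate_strong_def log_mono)
qed

lemma oma_rate_le_noma_rate_weak:
  assumes "\<rho> > 0" "g > 0" "a' \<ge> 0" "a \<ge> 0" "a \<le> noma_upper \<rho> g a'"
  shows "oma_rate \<rho> g a' \<le> noma_rate_weak \<rho> g a (1 - a)"
proof -
  have t: "sqrt (1 + 2 * \<rho> * a' * g) > 0"
    using assms by (simp add: add_pos_nonneg)
  have d: "1 + \<rho> * a * g > 0"
    using assms by (simp add: add_pos_nonneg)
  \<comment> \<open>The two power fractions add up to 1, so signal, interference and noise together
    give \<open>1 + \<rho> * g\<close>, whatever the split \<open>a\<close>.\<close>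
  have "1 + \<rho> * (1 - a) * g / (1 + \<rho> * a * g) = (1 + \<rho> * g) / (1 + \<rho> * a * g)"
    using d by (simp add: field_simps)
  moreover have "sqrt (1 + 2 * \<rho> * a' * g) \<le> (1 + \<rho> * g) / (1 + \<rho> * a * g)"
    using assms d by (simp add: le_noma_upper_iff pos_le_divide_eq mult.commute)
  ultimately show ?thesis
    using assms t by (simp add: oma_rate_eq noma_rate_weak_def log_mono)
qed

theorem mainTheorem2:
  fixes \<rho> g1 g2 a1' a2' :: real
  assumes "\<rho> > 0" and "g1 \<ge> g2" and "g2 > 0"
    and "a1' \<in> {0..1}" and "a2' \<in> {0..1}" and "a1' + a2' = 1"
  shows "noma_lower \<rho> g1 a1' \<le> noma_upper \<rho> g2 a2' \<and>
    (\<forall>a1::real. noma_lower \<rho> g1 a1' \<le> a1 \<and> a1 \<le> noma_upper \<rho> g2 a2' \<longrightarrow>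
       a1 \<in> {0..1} \<and>
       noma_rate_strong \<rho> g1 a1 \<ge> oma_rate \<rho> g1 a1' \<and>
       noma_rate_weak \<rho> g2 a1 (1 - a1) \<ge> oma_rate \<rho> g2 a2')"
proof -
  have a': "a1' \<ge> 0" "a2' \<ge> 0" and g1: "g1 > 0"
    using assms by auto
  have "noma_lower \<rho> g1 a1' \<le> noma_lower \<rho> g2 a1'"
    using assms a' by (intro noma_lower_antimono) auto
  also have "\<dots> \<le> noma_upper \<rho> g2 a2'"
    using assms a' by (intro noma_lower_le_noma_upper) auto
  finally have "noma_lower \<rho> g1 a1' \<le> noma_upper \<rho> g2 a2'" .
  moreover have "a1 \<in> {0..1} \<and> noma_rate_strong \<rho> g1 a1 \<ge> oma_rate \<rho> g1 a1' \<and>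
      noma_rate_weak \<rho> g2 a1 (1 - a1) \<ge> oma_rate \<rho> g2 a2'"
    if L: "noma_lower \<rho> g1 a1' \<le> a1" and U: "a1 \<le> noma_upper \<rho> g2 a2'" for a1
  proof -
    \<comment> \<open>Besides being part of the claim, this feeds the weak user's bound, where it
      keeps the interference denominator positive.\<close>
    have "a1 \<ge> 0"
      using noma_lower_nonneg[OF \<open>\<rho> > 0\<close> g1 a'(1)] L by linarith
    moreover have "a1 \<le> 1"
      using noma_upper_le_1[OF \<open>\<rho> > 0\<close> \<open>g2 > 0\<close> a'(2)] U by linarith
    ultimately show ?thesis
      using oma_rate_le_noma_rate_strong[OF \<open>\<rho> > 0\<close> g1 a'(1) L]
        oma_rate_le_noma_rate_weak[OF \<open>\<rho> > 0\<close> \<open>g2 > 0\<close> a'(2) _ U]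
      by simp
  qed
  ultimately show ?thesis
    by blast
qed

end
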